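(* The binary trees $\{T_n\}_{n=1}^\infty$ do not admit uniformly bilipschitz embeddings into the diamonds $\{D_n\}_{n=1}^\infty$. That is, there do not exist $K<\infty$, numbers $m(n)\in\mathbb{N}$ and maps $f_n:V(T_n)\to V(D_{m(n)})$ ($n\in\mathbb{N}$) such that each $f_n$ is a bilipschitz embedding with distortion at most $K$.
   Context: $T_n$ (binary tree of depth $n$): vertices are all finite $0$-$1$ sequences of length at most $n$ (including the empty sequence); two vertices are adjacent if one sequence is obtained from the other by adding one term on the right. Diamonds: $D_0$ has two vertices joined by an edge; $D_i$ is obtained from $D_{i-1}$ by replacing each edge $uv$ by a quadrilateral $u,a,v,b$ (with new vertices $a,b$). Both are regarded as metric spaces on their vertex sets with the shortest path metric, each edge having length $1$. The distortion of a bilipschitz map $f$ is $\mathrm{Lip}(f)\cdot\mathrm{Lip}(f^{-1})$. *)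

theory Defs
  imports Complex_Main
begin

definition gdist :: "('a \<times> 'a) set \<Rightarrow> 'a \<Rightarrow> 'a \<Rightarrow> nat" where
  "gdist E u v = (LEAST k. (u, v) \<in> (E \<union> E\<inverse>) ^^ k)"

definition Tverts :: "nat \<Rightarrow> bool list set" where
  "Tverts n = {xs. length xs \<le> n}"

definition Tedges :: "nat \<Rightarrow> (bool list \<times> bool list) set" where
  "Tedges n = {(xs, xs @ [b]) | xs b. length xs < n}"

(* Diamond vertices: the two original vertices, and for each edge (u,v) replaced,
   the two new vertices a = Mid u v False, b = Mid u v True. *)
datatype dvert = Src | Tgt | Mid dvert dvert bool

primrec Dedges :: "nat \<Rightarrow> (dvert \<times> dvert) set" where
  "Dedges 0 = {(Src, Tgt)}"
| "Dedges (Suc i) = (\<Union>(u, v) \<in> Dedges i.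
      {(u, Mid u v False), (Mid u v False, v), (u, Mid u v True), (Mid u v True, v)})"

definition Dverts :: "nat \<Rightarrow> dvert set" where
  "Dverts i = fst ` Dedges i \<union> snd ` Dedges i"

definition lip :: "('a \<Rightarrow> 'a \<Rightarrow> real) \<Rightarrow> ('b \<Rightarrow> 'b \<Rightarrow> real) \<Rightarrow> 'a set \<Rightarrow> ('a \<Rightarrow> 'b) \<Rightarrow> real" where
  "lip dA dB A f = (SUP p \<in> {(x, y). x \<in> A \<and> y \<in> A \<and> x \<noteq> y}. dB (f (fst p)) (f (snd p)) / dA (fst p) (snd p))"

definition distortion :: "('a \<Rightarrow> 'a \<Rightarrow> real) \<Rightarrow> ('b \<Rightarrow> 'b \<Rightarrow> real) \<Rightarrow> 'a set \<Rightarrow> ('a \<Rightarrow> 'b) \<Rightarrow> real" where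
  "distortion dA dB A f = lip dA dB A f * lip dB dA (f ` A) (inv_into A f)"

definition dT :: "nat \<Rightarrow> bool list \<Rightarrow> bool list \<Rightarrow> real" where
  "dT n x y = real (gdist (Tedges n) x y)"

definition dD :: "nat \<Rightarrow> dvert \<Rightarrow> dvert \<Rightarrow> real" where
  "dD m x y = real (gdist (Dedges m) x y)"

end

theory Submission
  imports Defs
begin

text \<open>
  Let \<open>f\<close> embed the tree of depth \<open>n\<close> with Lipschitz constant \<open>\<alpha>\<close> and inverse Lipschitz constant
  \<open>\<beta>\<close>, where \<open>\<alpha> * \<beta> \<le> K\<close>. Every edge \<open>(u, v)\<close> of generation \<open>j\<close> spans a subdiamond of
  \<open>D\<^sub>m\<close> of diameter about \<open>2 ^ (m - j)\<close> that is attached to the rest only at \<open>u\<close> and \<open>v\<close>.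
  Hence, if only boundedly many vertices of generation \<open>j\<close> come within \<open>\<alpha>\<close> of the image, all but
  boundedly many levels of some subtree are mapped into a single subdiamond. Vertices of generation
  \<open>j\<close> are \<open>2 ^ (m - j)\<close>-separated, so at a scale slightly above \<open>n * \<alpha>\<close> at most one of them is
  near the image; this traps a subtree in a subdiamond of that scale. That subdiamond contains at
  most \<open>2 * 4 ^ t\<close> vertices of the next \<open>t\<close> generations, so a second application traps a subtree of
  depth at least \<open>n / 2\<close> in a subdiamond \<open>2 ^ t\<close> times smaller. When \<open>2 ^ t\<close> is large compared to
  \<open>K\<close>, this contradicts the lower bound on distances in the image.
\<close>

section \<open>Graph distance\<close>

lemma gdist_le: "(u, v) \<in> (E \<union> E\<inverse>) ^^ k \<Longrightarrow> gdist E u v \<le> k"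
  unfolding gdist_def by (rule Least_le)

text \<open>\<open>gdist\<close> is a \<open>LEAST\<close>, so a walk of that length is guaranteed
  only when some walk exists. This is why later lemmas carry reachability hypotheses.\<close>

lemma relpow_gdist: "(u, v) \<in> (E \<union> E\<inverse>)\<^sup>* \<Longrightarrow> (u, v) \<in> (E \<union> E\<inverse>) ^^ gdist E u v"
  unfolding gdist_def by (rule LeastI_ex) (simp add: rtrancl_power)

lemma gdist_triangle:
  assumes "(u, v) \<in> (E \<union> E\<inverse>)\<^sup>*" "(v, w) \<in> (E \<union> E\<inverse>)\<^sup>*"
  shows "gdist E u w \<le> gdist E u v + gdist E v w"
proof (rule gdist_le)
  show "(u, w) \<in> (E \<union> E\<inverse>) ^^ (gdist E u v + gdist E v w)"
    using assms by (auto simp: relpow_add intro: relpow_gdist)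
qed

lemma relpow_sym_closure:
  assumes "(u, v) \<in> (E \<union> E\<inverse>) ^^ k" shows "(v, u) \<in> (E \<union> E\<inverse>) ^^ k"
  using assms
proof (induction k arbitrary: v)
  case (Suc k)
  then obtain w where w: "(u, w) \<in> (E \<union> E\<inverse>) ^^ k" "(w, v) \<in> E \<union> E\<inverse>" by auto
  then have "(v, w) \<in> E \<union> E\<inverse>" by auto
  with Suc.IH[OF w(1)] show ?case by (blast intro: relpow_Suc_I2)
qed simp

lemma gdist_sym: "gdist E u v = gdist E v u"
  unfolding gdist_def by (metis relpow_sym_closure)

lemma gdist_pos:
  assumes "(u, v) \<in> (E \<union> E\<inverse>)\<^sup>*" "u \<noteq> v"
  shows "gdist E u v > 0"
  using relpow_gdist[OF assms(1)] assms(2) by (cases "gdist E u v") auto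

lemma lipschitz_relpow:
  fixes \<phi> :: "'a \<Rightarrow> real" and c :: real
  assumes "\<And>x y. (x, y) \<in> E \<Longrightarrow> \<bar>\<phi> x - \<phi> y\<bar> \<le> c"
    and "(x, y) \<in> (E \<union> E\<inverse>) ^^ k"
  shows "\<bar>\<phi> x - \<phi> y\<bar> \<le> k * c"
  using assms(2)
proof (induction k arbitrary: y)
  case (Suc k)
  then obtain w where w: "(x, w) \<in> (E \<union> E\<inverse>) ^^ k" "(w, y) \<in> E \<union> E\<inverse>" by auto
  have "\<bar>\<phi> w - \<phi> y\<bar> \<le> c"
    using w(2) assms(1)[of w y] assms(1)[of y w] by (auto simp: abs_minus_commute)
  with Suc.IH[OF w(1)] show ?case by (simp add: algebra_simps)
qed simp

text \<open>Source of the quantitative lower bounds on distances: a potential that changes little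
  along each edge forces walks between very different values to be long.\<close>

lemma lipschitz_gdist:
  fixes \<phi> :: "'a \<Rightarrow> real" and c :: real
  assumes "\<And>x y. (x, y) \<in> E \<Longrightarrow> \<bar>\<phi> x - \<phi> y\<bar> \<le> c"
    and "(x, y) \<in> (E \<union> E\<inverse>)\<^sup>*"
  shows "\<bar>\<phi> x - \<phi> y\<bar> \<le> gdist E x y * c"
  using lipschitz_relpow[OF assms(1) relpow_gdist[OF assms(2)]] .

section \<open>Binary trees\<close>

lemma finite_Tverts: "finite (Tverts n)"
  using finite_lists_length_le[of "UNIV :: bool set" n] by (simp add: Tverts_def)

lemma Tedges_root_relpow:
  "xs \<in> Tverts n \<Longrightarrow> ([], xs) \<in> (Tedges n \<union> (Tedges n)\<inverse>) ^^ length xs"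
proof (induction xs rule: rev_induct)
  case (snoc b xs)
  then have "(xs, xs @ [b]) \<in> Tedges n" by (auto simp: Tedges_def Tverts_def)
  with snoc show ?case by (auto simp: Tverts_def)
qed simp

lemma Tedges_connected:
  assumes "x \<in> Tverts n" "y \<in> Tverts n"
  shows "(x, y) \<in> (Tedges n \<union> (Tedges n)\<inverse>)\<^sup>*"
  using relpow_sym_closure[OF Tedges_root_relpow[OF assms(1)]] Tedges_root_relpow[OF assms(2)]
  by (meson relpow_imp_rtrancl rtrancl_trans)

lemma dT_le:
  assumes "x \<in> Tverts n" "y \<in> Tverts n"
  shows "dT n x y \<le> 2 * n"
proof -
  have "(x, y) \<in> (Tedges n \<union> (Tedges n)\<inverse>) ^^ (length x + length y)"
    using relpow_sym_closure[OF Tedges_root_relpow[OF assms(1)]] Tedges_root_relpow[OF assms(2)]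
    by (auto simp: relpow_add)
  then have "gdist (Tedges n) x y \<le> length x + length y" by (rule gdist_le)
  then show ?thesis using assms by (simp add: dT_def Tverts_def)
qed

lemma dT_snoc_le:
  assumes "x @ [b] \<in> Tverts n" shows "dT n x (x @ [b]) \<le> 1"
proof -
  have "(x, x @ [b]) \<in> (Tedges n \<union> (Tedges n)\<inverse>) ^^ 1"
    using assms by (auto simp: Tedges_def Tverts_def)
  then show ?thesis using gdist_le by (fastforce simp: dT_def)
qed

lemma dT_ge_length_diff:
  assumes "x \<in> Tverts n" "y \<in> Tverts n"
  shows "\<bar>real (length x) - real (length y)\<bar> \<le> dT n x y"
proof -
  have "\<bar>real (length u) - real (length v)\<bar> \<le> 1" if "(u, v) \<in> Tedges n" for u v
    using that by (auto simp: Tedges_def)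
  from lipschitz_gdist[OF this Tedges_connected[OF assms]] show ?thesis by (simp add: dT_def)
qed

lemma dT_ge_branch:
  assumes "x \<in> Tverts n" "y \<in> Tverts n" "take h x \<noteq> take h y" "h \<le> length x"
  shows "real (length x) - h \<le> dT n x y"
proof -
  \<comment> \<open>\<open>\<phi>\<close> is the depth below level \<open>h\<close> inside the
    branch of \<open>x\<close> and 0 outside. An edge entering that branch ends at depth
    \<open>h\<close>, where \<open>\<phi>\<close> is still 0, so no edge jumps by more than
    1.\<close>
  define \<phi> where "\<phi> z = (if take h z = take h x then real (length z) - h else 0)" for z
  have "\<bar>\<phi> u - \<phi> v\<bar> \<le> 1" if uv: "(u, v) \<in> Tedges n" for u v
  proof -
    obtain b where v: "v = u @ [b]" using uv by (auto simp: Tedges_def)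
    consider "h \<le> length u" | "length u < h" by linarith
    then show ?thesis
    proof cases
      case 2
      then have "take h u \<noteq> take h x"
        using assms(4) by (metis length_take min.absorb2 min_less_iff_conj nat_less_le min_def)
      moreover have "length v = h" if "take h v = take h x"
        using that 2 assms(4) v by (metis Suc_leI length_append_singleton length_take min.absorb2 take_all)
      ultimately show ?thesis by (auto simp: \<phi>_def)
    qed (auto simp: \<phi>_def v)
  qed
  from lipschitz_gdist[where \<phi> = \<phi>, OF this Tedges_connected[OF assms(1,2)]] show ?thesis
    using assms(3) by (simp add: \<phi>_def dT_def)
qed

section \<open>Diamonds\<close>

text \<open>One subdivision step on an arbitrary edge set. Thus \<open>(expand ^^ k) {e}\<close> is
  the subdiamond that grows out of a single edge \<open>e\<close> in \<open>k\<close> steps.\<close>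

definition expand :: "(dvert \<times> dvert) set \<Rightarrow> (dvert \<times> dvert) set" where
  "expand E = (\<Union>(u, v) \<in> E.
      {(u, Mid u v False), (Mid u v False, v), (u, Mid u v True), (Mid u v True, v)})"

lemma expand_iff:
  "(a, b) \<in> expand E \<longleftrightarrow>
     (\<exists>v c. (a, v) \<in> E \<and> b = Mid a v c) \<or> (\<exists>u c. (u, b) \<in> E \<and> a = Mid u b c)"
  unfolding expand_def by (auto simp: ex_bool_eq)

lemma Field_expand: "Field (expand E) = Field E \<union> {Mid u v c | u v c. (u, v) \<in> E}"
proof (intro equalityI subsetI)
  fix x assume "x \<in> Field (expand E)"
  then obtain y where "(x, y) \<in> expand E \<or> (y, x) \<in> expand E" unfolding Field_def by blast
  then show "x \<in> Field E \<union> {Mid u v c | u v c. (u, v) \<in> E}"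
    unfolding expand_iff Field_def by blast
next
  fix x assume "x \<in> Field E \<union> {Mid u v c | u v c. (u, v) \<in> E}"
  then obtain u v c where "(u, v) \<in> E" "x = u \<or> x = v \<or> x = Mid u v c"
    by (auto simp: Field_def)
  moreover from this have "(u, Mid u v c) \<in> expand E" "(Mid u v c, v) \<in> expand E"
    by (auto simp: expand_iff)
  ultimately show "x \<in> Field (expand E)" by (auto simp: Field_def)
qed

lemma Dedges_funpow: "Dedges i = (expand ^^ i) {(Src, Tgt)}"
  by (induction i) (simp_all add: expand_def)

lemma Dverts_Field: "Dverts i = Field (Dedges i)"
  by (simp add: Dverts_def Field_def Domain_fst Range_snd)

lemma expand_UN: "expand (\<Union>i\<in>I. E i) = (\<Union>i\<in>I. expand (E i))"
  by (auto simp: expand_def)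

lemma expand_funpow_UN: "(expand ^^ k) E = (\<Union>e\<in>E. (expand ^^ k) {e})"
  by (induction k) (simp_all add: expand_UN)

lemma Dedges_add: "Dedges (j + k) = (\<Union>e\<in>Dedges j. (expand ^^ k) {e})"
proof -
  have "Dedges (j + k) = (expand ^^ k) (Dedges j)"
    by (simp add: Dedges_funpow add.commute[of j] funpow_add)
  also have "\<dots> = (\<Union>e\<in>Dedges j. (expand ^^ k) {e})" by (rule expand_funpow_UN)
  finally show ?thesis .
qed

lemma expand_disjoint:
  assumes "E \<inter> F = {}" shows "expand E \<inter> expand F = {}"
proof -
  \<comment> \<open>A new edge reveals its parent edge through its \<open>Mid\<close> end, once it
    is known which end that is. Term size excludes that each end is a middle built from the
    other.\<close>
  have acyclic: "\<not> (b = Mid a v c \<and> a = Mid u b d)" for a b u v c d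
  proof
    assume "b = Mid a v c \<and> a = Mid u b d"
    then have "size b = size (Mid a v c)" "size a = size (Mid u b d)" by (blast intro: arg_cong)+
    then show False by simp
  qed
  have False if "(a, b) \<in> expand E" "(a, b) \<in> expand F" for a b
    using that assms acyclic unfolding expand_iff by (metis disjoint_iff dvert.inject)
  then show ?thesis by auto
qed

lemma expand_funpow_disjoint:
  "E \<inter> F = {} \<Longrightarrow> (expand ^^ k) E \<inter> (expand ^^ k) F = {}"
  by (induction k) (simp_all add: expand_disjoint)

section \<open>Generations of vertices and the gluing of subdiamonds\<close>

primrec birth :: "dvert \<Rightarrow> nat" where
  "birth Src = 0"
| "birth Tgt = 0"
| "birth (Mid u v c) = Suc (max (birth u) (birth v))"

text \<open>Each subdivision puts a fresh vertex on every edge. Hence the middle of an edge of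
  \<open>Dedges i\<close> has birth \<open>i + 1\<close> and does not yet occur in
  \<open>Dedges i\<close>.\<close>

lemma birth_Dedges: "(u, v) \<in> Dedges i \<Longrightarrow> max (birth u) (birth v) = i"
proof (induction i arbitrary: u v)
  case (Suc i)
  then have "(u, v) \<in> expand (Dedges i)" by (simp add: expand_def)
  with Suc.IH show ?case by (fastforce simp: expand_iff)
qed simp

lemma birth_Field_Dedges: "x \<in> Field (Dedges i) \<Longrightarrow> birth x \<le> i"
  using birth_Dedges by (fastforce simp: Field_def)

lemma funpow_expand_subset: "e \<in> Dedges j \<Longrightarrow> (expand ^^ k) {e} \<subseteq> Dedges (j + k)"
  by (auto simp: Dedges_add)

text \<open>A subdivision adds only fresh vertices, each recording the edge it subdivides. As the
  two edge sets stay disjoint, no added vertex is shared, so common vertices go back to the original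
  edges.\<close>

lemma Field_subdiamonds_Int:
  assumes "e \<in> Dedges j" "e' \<in> Dedges j" "e \<noteq> e'"
  shows "Field ((expand ^^ k) {e}) \<inter> Field ((expand ^^ k) {e'}) \<subseteq> Field {e}"
proof (induction k)
  case (Suc k)
  let ?A = "(expand ^^ k) {e}" and ?B = "(expand ^^ k) {e'}"
  have sub: "?A \<subseteq> Dedges (j + k)" "?B \<subseteq> Dedges (j + k)"
    using assms funpow_expand_subset by auto
  have disj: "?A \<inter> ?B = {}" using assms by (intro expand_funpow_disjoint) auto
  have fresh: "Mid u v c \<notin> Field (Dedges (j + k))" if "(u, v) \<in> Dedges (j + k)" for u v c
    using birth_Dedges[OF that] birth_Field_Dedges[of "Mid u v c" "j + k"] by auto
  have old: "Mid u v c \<notin> Field ?A" "Mid u v c \<notin> Field ?B" if "(u, v) \<in> ?A \<union> ?B" for u v c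
    using that sub fresh[of u v c] mono_Field[OF sub(1)] mono_Field[OF sub(2)] by blast+
  show ?case using Suc old disj by (auto simp: Field_expand)
qed auto

text \<open>A subdiamond is glued to the others only at \<open>u\<close> and \<open>v\<close>, so a
  walk leaving it passes through one of them; the part of the walk up to there bounds the
  distance.\<close>

lemma Dedges_exit_subdiamond:
  assumes "(u, v) \<in> Dedges j"
    and "(x, y) \<in> (Dedges (j + k) \<union> (Dedges (j + k))\<inverse>) ^^ l"
    and "x \<in> Field ((expand ^^ k) {(u, v)})" "y \<notin> Field ((expand ^^ k) {(u, v)})"
  shows "\<exists>w\<in>{u, v}. gdist (Dedges (j + k)) x w \<le> l"
  using assms(2,4)
proof (induction l arbitrary: y)
  case 0 then show ?case using assms(3) by simp
next
  case (Suc l)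
  let ?S = "Field ((expand ^^ k) {(u, v)})"
  obtain z where z: "(x, z) \<in> (Dedges (j + k) \<union> (Dedges (j + k))\<inverse>) ^^ l"
    "(z, y) \<in> Dedges (j + k) \<union> (Dedges (j + k))\<inverse>" using Suc.prems by auto
  show ?case
  proof (cases "z \<in> ?S")
    case False
    then show ?thesis using Suc.IH[OF z(1)] le_SucI by blast
  next
    case True
    obtain e where e: "e \<in> Dedges j" "(z, y) \<in> (expand ^^ k) {e} \<or> (y, z) \<in> (expand ^^ k) {e}"
      using z(2) by (auto simp: Dedges_add)
    then have zy: "z \<in> Field ((expand ^^ k) {e})" "y \<in> Field ((expand ^^ k) {e})"
      by (auto simp: Field_def)
    with Suc.prems(2) have "e \<noteq> (u, v)" by auto
    with Field_subdiamonds_Int[OF assms(1) e(1), of k] zy True have "z \<in> {u, v}" by auto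
    then show ?thesis using gdist_le[OF z(1)] le_SucI by blast
  qed
qed

section \<open>Walks, diameter and size of subdiamonds\<close>

lemma expand_relpow:
  "(x, y) \<in> (E \<union> E\<inverse>) ^^ l \<Longrightarrow> (x, y) \<in> (expand E \<union> (expand E)\<inverse>) ^^ (2 * l)"
proof (induction l arbitrary: y)
  case (Suc l)
  let ?R = "expand E \<union> (expand E)\<inverse>"
  obtain z where z: "(x, z) \<in> (E \<union> E\<inverse>) ^^ l" "(z, y) \<in> E \<union> E\<inverse>" using Suc.prems by auto
  have "(z, y) \<in> ?R O ?R"
    using z(2)
  proof
    assume "(z, y) \<in> E"
    then have "(z, Mid z y True) \<in> ?R" "(Mid z y True, y) \<in> ?R" by (auto simp: expand_iff)
    then show ?thesis by blast
  next
    assume "(z, y) \<in> E\<inverse>"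
    then have "(z, Mid y z True) \<in> ?R" "(Mid y z True, y) \<in> ?R" by (auto simp: expand_iff)
    then show ?thesis by blast
  qed
  moreover have "?R ^^ (2 * Suc l) = ?R ^^ (2 * l) O (?R O ?R)" by (simp add: O_assoc)
  ultimately show ?case using Suc.IH[OF z(1)] by blast
qed simp

text \<open>Old walks double in length and a new middle costs one more step. The strict bound
  absorbs that step: \<open>l < 2 * 2 ^ k\<close> gives
  \<open>2 * l + 1 < 2 * 2 ^ Suc k\<close>.\<close>

lemma subdiamond_relpow:
  "x \<in> Field ((expand ^^ k) {(u, v)}) \<Longrightarrow>
   \<exists>l < 2 * 2 ^ k. (u, x) \<in> ((expand ^^ k) {(u, v)} \<union> ((expand ^^ k) {(u, v)})\<inverse>) ^^ l"
proof (induction k arbitrary: x)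
  case 0
  then have "x = u \<or> x = v" by auto
  then show ?case
  proof
    assume "x = u" then show ?thesis by (intro exI[of _ 0]) simp
  next
    assume "x = v" then show ?thesis by (intro exI[of _ 1]) simp
  qed
next
  case (Suc k)
  let ?A = "(expand ^^ k) {(u, v)}"
  let ?R = "expand ?A \<union> (expand ?A)\<inverse>"
  have old: "\<exists>l. l + 1 < 2 * 2 ^ Suc k \<and> (u, y) \<in> ?R ^^ l" if y: "y \<in> Field ?A" for y
  proof -
    obtain l where l: "l < 2 * 2 ^ k" "(u, y) \<in> (?A \<union> ?A\<inverse>) ^^ l" using Suc.IH[OF y] by auto
    then show ?thesis using expand_relpow[OF l(2)] by (intro exI[of _ "2 * l"]) auto
  qed
  have "x \<in> Field (expand ?A)" using Suc.prems by simp
  then consider "x \<in> Field ?A" | a b c where "(a, b) \<in> ?A" "x = Mid a b c"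
    by (auto simp: Field_expand)
  then show ?case
  proof cases
    case 1
    then show ?thesis using old[of x] by (auto intro: Suc_lessD)
  next
    case 2
    then have "(a, x) \<in> ?R" by (auto simp: expand_iff)
    moreover have "a \<in> Field ?A" using 2 by (auto simp: Field_def)
    then obtain l where "l + 1 < 2 * 2 ^ Suc k" "(u, a) \<in> ?R ^^ l" using old by blast
    ultimately show ?thesis by (intro exI[of _ "Suc l"]) auto
  qed
qed

lemma relpow_mono: "R \<subseteq> S \<Longrightarrow> R ^^ k \<subseteq> S ^^ k" for R S :: "('a \<times> 'a) set"
  by (induction k) (auto simp: relcomp_mono)

lemma subdiamond_relpow_pair:
  assumes "(u, v) \<in> Dedges j" "x \<in> Field ((expand ^^ k) {(u, v)})" "y \<in> Field ((expand ^^ k) {(u, v)})"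
  shows "\<exists>l \<le> 4 * 2 ^ k. (x, y) \<in> (Dedges (j + k) \<union> (Dedges (j + k))\<inverse>) ^^ l"
proof -
  let ?A = "(expand ^^ k) {(u, v)}"
  obtain l1 l2 where l: "l1 < 2 * 2 ^ k" "(u, x) \<in> (?A \<union> ?A\<inverse>) ^^ l1"
      "l2 < 2 * 2 ^ k" "(u, y) \<in> (?A \<union> ?A\<inverse>) ^^ l2"
    using subdiamond_relpow assms(2,3) by meson
  have "(x, y) \<in> (?A \<union> ?A\<inverse>) ^^ (l1 + l2)"
    using relpow_sym_closure[OF l(2)] l(4) by (auto simp: relpow_add)
  moreover have "?A \<union> ?A\<inverse> \<subseteq> Dedges (j + k) \<union> (Dedges (j + k))\<inverse>"
    using funpow_expand_subset[OF assms(1)] by blast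
  ultimately have "(x, y) \<in> (Dedges (j + k) \<union> (Dedges (j + k))\<inverse>) ^^ (l1 + l2)"
    using relpow_mono by blast
  then show ?thesis using l by (intro exI[of _ "l1 + l2"]) auto
qed

lemma subdiamond_diameter:
  assumes "(u, v) \<in> Dedges j" "x \<in> Field ((expand ^^ k) {(u, v)})" "y \<in> Field ((expand ^^ k) {(u, v)})"
  shows "gdist (Dedges (j + k)) x y \<le> 4 * 2 ^ k"
proof -
  obtain l where "l \<le> 4 * 2 ^ k" "(x, y) \<in> (Dedges (j + k) \<union> (Dedges (j + k))\<inverse>) ^^ l"
    using subdiamond_relpow_pair[OF assms] by blast
  then show ?thesis using gdist_le le_trans by metis
qed

lemma Dedges_connected:
  assumes "x \<in> Field (Dedges m)" "y \<in> Field (Dedges m)"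
  shows "(x, y) \<in> (Dedges m \<union> (Dedges m)\<inverse>)\<^sup>*"
  using subdiamond_relpow_pair[of Src Tgt 0 x m y] assms
  by (auto simp: Dedges_funpow[of m] dest: relpow_imp_rtrancl)

lemma Field_expand_funpow_mono: "Field E \<subseteq> Field ((expand ^^ k) E)"
  by (induction k) (auto simp: Field_expand)

lemma Field_Dedges_mono: "Field (Dedges j) \<subseteq> Field (Dedges (j + k))"
  using Field_expand_funpow_mono[of "Dedges j" k]
  by (simp add: Dedges_funpow add.commute[of j] funpow_add)

lemma card_expand: "finite E \<Longrightarrow> finite (expand E) \<and> card (expand E) \<le> 4 * card E"
proof -
  assume E: "finite E"
  let ?q = "\<lambda>(u, v). {(u, Mid u v False), (Mid u v False, v), (u, Mid u v True), (Mid u v True, v)}"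
  have "card (expand E) \<le> (\<Sum>e\<in>E. card (?q e))"
    unfolding expand_def using E by (rule card_UN_le)
  also have "\<dots> \<le> (\<Sum>e\<in>E. 4)"
  proof (rule sum_mono)
    fix e :: "dvert \<times> dvert"
    obtain u v where e: "e = (u, v)" by force
    show "card (?q e) \<le> 4"
      using card_length[of "[(u, Mid u v False), (Mid u v False, v), (u, Mid u v True), (Mid u v True, v)]"]
      unfolding e by simp
  qed
  finally show ?thesis using E by (auto simp: expand_def)
qed

lemma card_Field_subdiamond:
  "finite (Field ((expand ^^ k) {e})) \<and> card (Field ((expand ^^ k) {e})) \<le> 2 * 4 ^ k"
proof -
  have *: "finite ((expand ^^ k) {e}) \<and> card ((expand ^^ k) {e}) \<le> 4 ^ k"
  proof (induction k)
    case (Suc k)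
    then show ?case using card_expand[of "(expand ^^ k) {e}"] by auto
  qed simp
  let ?A = "(expand ^^ k) {e}"
  have "card (Field ?A) \<le> card (fst ` ?A) + card (snd ` ?A)"
    by (simp add: Field_def Domain_fst Range_snd card_Un_le)
  also have "\<dots> \<le> card ?A + card ?A" using * by (intro add_mono card_image_le) auto
  finally show ?thesis using * by (auto simp: finite_Field)
qed

text \<open>Indicator of \<open>w\<close> among the vertices of generation at most \<open>j\<close>, extended to later
  vertices by averaging over the two ends of the subdivided edge.\<close>

primrec bump :: "nat \<Rightarrow> dvert \<Rightarrow> dvert \<Rightarrow> real" where
  "bump j w Src = (if w = Src then 1 else 0)"
| "bump j w Tgt = (if w = Tgt then 1 else 0)"
| "bump j w (Mid u v c) = (if birth (Mid u v c) \<le> j then (if w = Mid u v c then 1 else 0)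
     else (bump j w u + bump j w v) / 2)"

lemma bump_old: "birth x \<le> j \<Longrightarrow> bump j w x = (if w = x then 1 else 0)"
  by (cases x) auto

text \<open>A middle gets the mean of its two ends, so every subdivision halves the differences
  along edges, starting from at most 1 in generation \<open>j\<close>.\<close>

lemma bump_lipschitz: "(x, y) \<in> Dedges (j + k) \<Longrightarrow> \<bar>bump j w x - bump j w y\<bar> \<le> 1 / 2 ^ k"
proof (induction k arbitrary: x y)
  case 0
  then have "max (birth x) (birth y) = j" using birth_Dedges by simp
  then show ?case using bump_old[of x j w] bump_old[of y j w] by auto
next
  case (Suc k)
  define d :: real where "d = 1 / 2 ^ k"
  have step: "\<bar>bump j w (Mid u v c) - bump j w u\<bar> \<le> d / 2"
      "\<bar>bump j w (Mid u v c) - bump j w v\<bar> \<le> d / 2" if "(u, v) \<in> Dedges (j + k)" for u v c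
  proof -
    have mid: "bump j w (Mid u v c) = (bump j w u + bump j w v) / 2"
      using birth_Dedges[OF that] by simp
    have "\<bar>bump j w u - bump j w v\<bar> \<le> d" using Suc.IH[OF that] by (simp add: d_def)
    then show "\<bar>bump j w (Mid u v c) - bump j w u\<bar> \<le> d / 2"
      "\<bar>bump j w (Mid u v c) - bump j w v\<bar> \<le> d / 2"
      unfolding mid by (auto simp: abs_le_iff field_simps)
  qed
  have "(x, y) \<in> expand (Dedges (j + k))" using Suc.prems by (simp add: expand_def)
  then have "\<bar>bump j w x - bump j w y\<bar> \<le> d / 2"
    unfolding expand_iff using step by (metis abs_minus_commute)
  then show ?case by (simp add: d_def)
qed

text \<open>\<open>bump j w\<close> drops from 1 at \<open>w\<close> to 0 at \<open>w'\<close>, by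
  at most \<open>1 / 2 ^ k\<close> per edge.\<close>

lemma gdist_old_vertices_ge:
  assumes "w \<in> Field (Dedges j)" "w' \<in> Field (Dedges j)" "w \<noteq> w'"
  shows "2 ^ k \<le> gdist (Dedges (j + k)) w w'"
proof -
  have "(w, w') \<in> (Dedges (j + k) \<union> (Dedges (j + k))\<inverse>)\<^sup>*"
    using assms Field_Dedges_mono[of j k] by (intro Dedges_connected) auto
  from lipschitz_gdist[where \<phi> = "bump j w", OF bump_lipschitz this]
  have "1 \<le> gdist (Dedges (j + k)) w w' / 2 ^ k"
    using assms by (simp add: bump_old birth_Field_Dedges)
  then have "real (2 ^ k) \<le> real (gdist (Dedges (j + k)) w w')" by (simp add: field_simps)
  then show ?thesis by linarith
qed


section \<open>Embeddings of trees into diamonds\<close>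

text \<open>The suprema in \<open>distortion\<close> are replaced by pointwise two-sided bounds;
  injectivity of \<open>f\<close> is implicit in \<open>lower\<close>.\<close>

locale tree_in_diamond =
  fixes n m :: nat and f :: "bool list \<Rightarrow> dvert" and \<alpha> \<beta> K :: real
  assumes into: "x \<in> Tverts n \<Longrightarrow> f x \<in> Field (Dedges m)"
    and upper: "x \<in> Tverts n \<Longrightarrow> y \<in> Tverts n \<Longrightarrow> dD m (f x) (f y) \<le> \<alpha> * dT n x y"
    and lower: "x \<in> Tverts n \<Longrightarrow> y \<in> Tverts n \<Longrightarrow> dT n x y \<le> \<beta> * dD m (f x) (f y)"
    and pos: "0 \<le> \<alpha>" "0 \<le> \<beta>"
    and prod_le: "\<alpha> * \<beta> \<le> K"
begin

lemma dD_triangle: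
  assumes "x \<in> Field (Dedges m)" "y \<in> Field (Dedges m)" "z \<in> Field (Dedges m)"
  shows "dD m x z \<le> dD m x y + dD m y z"
  using gdist_triangle[OF Dedges_connected[OF assms(1,2)] Dedges_connected[OF assms(2,3)]]
  by (simp add: dD_def)

lemma dD_sym: "dD m x y = dD m y x"
  by (simp add: dD_def gdist_sym)

text \<open>The two images are within \<open>2 * \<alpha>\<close> of each other, and
  \<open>lower\<close> turns this into \<open>2 * \<alpha> * \<beta>\<close> in the tree.\<close>

lemma near_same_vertex:
  assumes "x \<in> Tverts n" "y \<in> Tverts n" "w \<in> Field (Dedges m)"
    and "dD m (f x) w \<le> \<alpha>" "dD m (f y) w \<le> \<alpha>"
  shows "dT n x y \<le> 2 * K"
proof -
  have "dD m (f x) (f y) \<le> 2 * \<alpha>"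
    using dD_triangle[OF into[OF assms(1)] assms(3) into[OF assms(2)]] assms(4,5) dD_sym[of w "f y"]
    by simp
  then have "\<beta> * dD m (f x) (f y) \<le> \<beta> * (2 * \<alpha>)" using pos by (intro mult_left_mono)
  with lower[OF assms(1,2)] prod_le show ?thesis by (simp add: mult.commute mult.left_commute)
qed

text \<open>A tree edge can leave a subdiamond only near one of its two ends, and the vertices mapped near
  a given \<open>w\<close> lie in a set of diameter at most \<open>2 * K\<close>. Far below depth \<open>h\<close> such a
  set meets only one of the \<open>2 ^ h\<close> branches, so with fewer than \<open>2 ^ h\<close> relevant \<open>w\<close> some
  branch meets none of them.\<close>

lemma subtree_into_subdiamond:
  assumes m: "m = j + k" and E: "E \<subseteq> Dedges j" and R: "2 * K \<le> real R"
    and len: "length z0 + h + R + 1 \<le> n"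
    and cover: "\<And>ys. z0 @ ys \<in> Tverts n \<Longrightarrow> \<exists>e\<in>E. f (z0 @ ys) \<in> Field ((expand ^^ k) {e})"
    and W: "finite W" "card W < 2 ^ h"
    and near: "\<And>ys w. z0 @ ys \<in> Tverts n \<Longrightarrow> w \<in> Field E \<Longrightarrow> dD m (f (z0 @ ys)) w \<le> \<alpha> \<Longrightarrow> w \<in> W"
  shows "\<exists>e\<in>E. \<exists>z. length z = h + R + 1 \<and>
    (\<forall>ys. z0 @ z @ ys \<in> Tverts n \<longrightarrow> f (z0 @ z @ ys) \<in> Field ((expand ^^ k) {e}))"
proof -
  \<comment> \<open>Only points more than \<open>R\<close> levels below the root of the branch
    count, so that hits in different branches are more than \<open>2 * K\<close> apart.\<close>
  define hits where "hits z w \<longleftrightarrow> (\<exists>ys. R < length ys \<and> z0 @ z @ ys \<in> Tverts n \<and>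
    dD m (f (z0 @ z @ ys)) w \<le> \<alpha>)" for z w
  have FE: "Field E \<subseteq> Field (Dedges m)"
    using mono_Field[OF E] Field_Dedges_mono[of j k] m by blast
  define B where "B = {z. length z = h \<and> (\<exists>w\<in>Field E. hits z w)}"
  have "\<forall>z\<in>B. \<exists>w. w \<in> Field E \<and> hits z w" by (auto simp: B_def)
  then obtain g where g: "\<And>z. z \<in> B \<Longrightarrow> g z \<in> Field E \<and> hits z (g z)" by metis
  \<comment> \<open>Two branches sharing a vertex would contain deep points that are more than
    \<open>R\<close> apart by \<open>dT_ge_branch\<close>, but at most \<open>2 * K\<close> apart by
    \<open>near_same_vertex\<close>.\<close>
  have "inj_on g B"
  proof (rule inj_onI, rule ccontr)
    fix z z' assume z: "z \<in> B" "z' \<in> B" "g z = g z'" "z \<noteq> z'"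
    obtain ys ys' where y: "R < length ys" "z0 @ z @ ys \<in> Tverts n" "dD m (f (z0 @ z @ ys)) (g z) \<le> \<alpha>"
      "z0 @ z' @ ys' \<in> Tverts n" "dD m (f (z0 @ z' @ ys')) (g z) \<le> \<alpha>"
      using g[OF z(1)] g[OF z(2)] z(3) by (auto simp: hits_def)
    have lz: "length z = h" "length z' = h" using z by (auto simp: B_def)
    have "real (length (z0 @ z @ ys)) - (length z0 + h) \<le> dT n (z0 @ z @ ys) (z0 @ z' @ ys')"
      using z(4) lz by (intro dT_ge_branch y) auto
    moreover have "dT n (z0 @ z @ ys) (z0 @ z' @ ys') \<le> 2 * K"
      using near_same_vertex y g[OF z(1)] FE by blast
    ultimately show False using R y(1) lz by simp
  qed
  moreover have "g ` B \<subseteq> W"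
    using g near by (force simp: hits_def)
  ultimately have "card B \<le> card W" using W(1) by (intro card_inj_on_le)
  also have "\<dots> < card {z :: bool list. length z = h}"
    using W(2) card_lists_length_eq[of "UNIV :: bool set" h] by simp
  finally have "B \<noteq> {z. length z = h}" by blast
  then obtain z where z: "length z = h" "z \<notin> B" by (auto simp: B_def)
  \<comment> \<open>Descending \<open>R + 1\<close> further levels makes every vertex from here on
    deep enough for \<open>hits\<close>.\<close>
  define z1 where "z1 = z @ replicate (R + 1) False"
  have "z0 @ z1 \<in> Tverts n" using len z by (simp add: z1_def Tverts_def)
  with cover obtain e where e: "e \<in> E" "f (z0 @ z1) \<in> Field ((expand ^^ k) {e})" by blast
  obtain u v where uv: "e = (u, v)" by force
  have "z0 @ z1 @ ys \<in> Tverts n \<Longrightarrow> f (z0 @ z1 @ ys) \<in> Field ((expand ^^ k) {e})" for ys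
  proof (induction ys rule: rev_induct)
    case Nil then show ?case using e by simp
  next
    case (snoc b ys)
    let ?x = "z0 @ z1 @ ys"
    have x: "?x \<in> Tverts n" "?x @ [b] \<in> Tverts n" using snoc.prems by (auto simp: Tverts_def)
    have fx: "f ?x \<in> Field ((expand ^^ k) {e})" using snoc.IH x by blast
    show ?case
    proof (rule ccontr)
      assume out: "f (z0 @ z1 @ ys @ [b]) \<notin> Field ((expand ^^ k) {e})"
      \<comment> \<open>The image of a tree edge has length at most \<open>\<alpha>\<close>; leaving
        the subdiamond would put \<open>f ?x\<close> that close to an end of \<open>e\<close>,
        against the choice of \<open>z\<close>.\<close>
      have "(f ?x, f (?x @ [b])) \<in> (Dedges m \<union> (Dedges m)\<inverse>) ^^ gdist (Dedges m) (f ?x) (f (?x @ [b]))"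
        by (intro relpow_gdist Dedges_connected into x)
      then obtain w where w: "w \<in> {u, v}" "gdist (Dedges m) (f ?x) w \<le> gdist (Dedges m) (f ?x) (f (?x @ [b]))"
        using Dedges_exit_subdiamond[of u v j "f ?x" "f (?x @ [b])" "gdist (Dedges m) (f ?x) (f (?x @ [b]))" k] e E fx out uv m by auto
      then have "dD m (f ?x) w \<le> dD m (f ?x) (f (?x @ [b]))" by (simp add: dD_def)
      also have "\<dots> \<le> \<alpha> * dT n ?x (?x @ [b])" using x by (rule upper)
      also have "\<dots> \<le> \<alpha> * 1" using dT_snoc_le[OF x(2)] pos by (intro mult_left_mono)
      finally have "hits z w"
        using x(1) by (auto simp: hits_def z1_def intro!: exI[of _ "replicate (R + 1) False @ ys"])
      moreover have "w \<in> Field E" using w e uv by (auto simp: Field_def)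
      ultimately show False using z by (auto simp: B_def)
    qed
  qed
  then show ?thesis using e z by (intro bexI[of _ e] exI[of _ z1]) (auto simp: z1_def)
qed

text \<open>Adjacent tree vertices have distinct images by \<open>lower\<close>, and distances in
  the diamond are integers.\<close>

lemma alpha_ge_1:
  assumes "n \<ge> 1" shows "1 \<le> \<alpha>"
proof -
  have x: "[] \<in> Tverts n" "[False] \<in> Tverts n" using assms by (auto simp: Tverts_def)
  have "1 \<le> dT n [] [False]" using dT_ge_length_diff[OF x] by simp
  then have "1 \<le> \<beta> * dD m (f []) (f [False])" using lower[OF x] by linarith
  then have "1 \<le> dD m (f []) (f [False])"
    by (cases "gdist (Dedges m) (f []) (f [False])") (auto simp: dD_def)
  also have "\<dots> \<le> \<alpha> * dT n [] [False]" by (rule upper[OF x])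
  also have "\<dots> \<le> \<alpha> * 1" using dT_snoc_le[of "[]" False n] x pos by (intro mult_left_mono) auto
  finally show ?thesis by simp
qed

lemma near_vertices_close:
  assumes "x \<in> Tverts n" "y \<in> Tverts n" "w \<in> Field (Dedges m)" "w' \<in> Field (Dedges m)"
    and "dD m (f x) w \<le> \<alpha>" "dD m (f y) w' \<le> \<alpha>"
  shows "dD m w w' \<le> (2 * n + 2) * \<alpha>"
proof -
  have "dD m w w' \<le> dD m (f x) w + dD m (f x) (f y) + dD m (f y) w'"
    using dD_triangle[OF assms(3) into[OF assms(1)] assms(4)] dD_sym[of w "f x"]
      dD_triangle[OF into[OF assms(1)] into[OF assms(2)] assms(4)] by linarith
  moreover have "dD m (f x) (f y) \<le> \<alpha> * (2 * n)"
    using upper[OF assms(1,2)] mult_left_mono[OF dT_le[OF assms(1,2)] pos(1)] by simp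
  ultimately show ?thesis using assms(5,6) by (simp add: algebra_simps)
qed

text \<open>\<open>H\<close> is the depth spent on the two trappings, with \<open>2 ^ 2\<close> and
  \<open>2 ^ (2 * t + 2)\<close> branches; at least half of the depth remains.\<close>

lemma depth_bounded:
  assumes t: "64 * K < 2 ^ t" and R: "2 * K \<le> real R" and n: "n \<ge> 1" "8 * K < n"
    and H: "H = (2 + R + 1) + ((2 * t + 2) + R + 1)" "2 * H \<le> n"
  shows False
proof -
  note \<alpha> = alpha_ge_1[OF n(1)]
  \<comment> \<open>\<open>2 ^ p\<close> is the first scale above the bound of
    \<open>near_vertices_close\<close>, capped at the whole diamond. Minimality yields
    \<open>scale\<close>, and for \<open>p = 0\<close> the bound \<open>1 \<le> \<alpha>\<close>
    does.\<close>
  define p where "p = (LEAST p. p = m \<or> (2 * n + 2) * \<alpha> < 2 ^ p)"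
  have p: "p = m \<or> (2 * n + 2) * \<alpha> < 2 ^ p"
    unfolding p_def by (rule LeastI[of _ m]) simp
  have "p \<le> m" unfolding p_def by (rule Least_le) simp
  have scale: "2 ^ p \<le> 2 * ((2 * n + 2) * \<alpha>)"
  proof (cases p)
    case 0
    have "1 \<le> (2 * n + 2) * \<alpha>" using \<alpha> mult_mono[of 1 "real (2 * n + 2)" 1 \<alpha>] by simp
    then show ?thesis using 0 by simp
  next
    case (Suc q)
    then have "\<not> (q = m \<or> (2 * n + 2) * \<alpha> < 2 ^ q)"
      unfolding p_def by (intro not_less_Least) simp
    then show ?thesis using Suc by simp
  qed
  define j where "j = m - p"
  have m: "m = j + p" using \<open>p \<le> m\<close> by (simp add: j_def)
  have Hn: "H \<le> n" using H by simp

  \<comment> \<open>If \<open>p = m\<close>, generation 0 has just the two poles. Otherwise the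
    separation \<open>2 ^ p\<close> exceeds the distance between vertices near the image, so at most
    one is near. Either way \<open>2 ^ 2\<close> branches suffice.\<close>
  define W where "W = {w \<in> Field (Dedges j). \<exists>x\<in>Tverts n. dD m (f x) w \<le> \<alpha>}"
  have "\<exists>a b. W \<subseteq> {a, b}"
    using p
  proof
    assume "p = m"
    then have "j = 0" by (simp add: j_def)
    then have "W \<subseteq> {Src, Tgt}" by (auto simp: W_def)
    then show ?thesis by blast
  next
    assume big: "(2 * n + 2) * \<alpha> < 2 ^ p"
    have "w = w'" if ww: "w \<in> W" "w' \<in> W" for w w'
    proof (rule ccontr)
      assume "w \<noteq> w'"
      then have "2 ^ p \<le> gdist (Dedges m) w w'"
        using ww gdist_old_vertices_ge[of w j w' p] by (simp add: W_def m)
      then have "2 ^ p \<le> dD m w w'" unfolding dD_def by (simp flip: of_nat_le_iff)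
      moreover have "dD m w w' \<le> (2 * n + 2) * \<alpha>"
      proof -
        obtain x y where "x \<in> Tverts n" "dD m (f x) w \<le> \<alpha>" "y \<in> Tverts n" "dD m (f y) w' \<le> \<alpha>"
          using ww by (auto simp: W_def)
        moreover have "w \<in> Field (Dedges m)" "w' \<in> Field (Dedges m)"
          using ww Field_Dedges_mono[of j p] m by (auto simp: W_def)
        ultimately show ?thesis by (intro near_vertices_close)
      qed
      ultimately show False using big by linarith
    qed
    then show ?thesis by blast
  qed
  then obtain a b where ab: "W \<subseteq> {a, b}" by blast
  have "card W \<le> card {a, b}" using ab by (intro card_mono) auto
  also have "\<dots> < 2 ^ 2" by (cases "a = b") auto
  finally have cardW: "card W < 2 ^ 2" .
  have "\<exists>e\<in>Dedges j. \<exists>z. length z = 2 + R + 1 \<and>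
    (\<forall>ys. [] @ z @ ys \<in> Tverts n \<longrightarrow> f ([] @ z @ ys) \<in> Field ((expand ^^ p) {e}))"
  proof (rule subtree_into_subdiamond[OF m subset_refl R _ _ _ cardW])
    show "length [] + 2 + R + 1 \<le> n" using H by simp
    show "finite W" using ab finite_subset by blast
    show "\<exists>e\<in>Dedges j. f ([] @ ys) \<in> Field ((expand ^^ p) {e})" if "[] @ ys \<in> Tverts n" for ys
      using into[OF that] unfolding m Dedges_add by (auto simp: Field_def)
    show "w \<in> W" if "[] @ ys \<in> Tverts n" "w \<in> Field (Dedges j)" "dD m (f ([] @ ys)) w \<le> \<alpha>" for ys w
      using that by (auto simp: W_def)
  qed
  then obtain e z where e: "e \<in> Dedges j" and z: "length z = 2 + R + 1"
    "\<And>ys. z @ ys \<in> Tverts n \<Longrightarrow> f (z @ ys) \<in> Field ((expand ^^ p) {e})" by auto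

  \<comment> \<open>Refinement by \<open>t\<close> generations, capped at \<open>p\<close>, where
    subdiamonds are single edges.\<close>
  define t' where "t' = min t p"
  define E where "E = (expand ^^ t') {e}"
  have m': "m = (j + t') + (p - t')" using m by (simp add: t'_def)
  have split: "(expand ^^ p) {e} = (\<Union>d\<in>E. (expand ^^ (p - t')) {d})"
  proof -
    have "(expand ^^ p) {e} = (expand ^^ ((p - t') + t')) {e}" by (simp add: t'_def)
    also have "\<dots> = (expand ^^ (p - t')) E" by (simp only: funpow_add E_def o_apply)
    also have "\<dots> = (\<Union>d\<in>E. (expand ^^ (p - t')) {d})" by (rule expand_funpow_UN)
    finally show ?thesis .
  qed
  have E: "E \<subseteq> Dedges (j + t')" unfolding E_def using e by (rule funpow_expand_subset)
  have "card (Field E) \<le> 2 * 4 ^ t'" "finite (Field E)"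
    unfolding E_def using card_Field_subdiamond by blast+
  moreover have "(2 :: nat) * 4 ^ t' \<le> 2 * 4 ^ t" by (simp add: t'_def)
  \<comment> \<open>This fixes the branching depth \<open>2 * t + 2\<close>: it provides
    \<open>4 * 4 ^ t\<close> branches against at most \<open>2 * 4 ^ t\<close> vertices.\<close>
  moreover have "(2 :: nat) * 4 ^ t < 2 ^ (2 * t + 2)" by (simp add: power_mult)
  ultimately have cardE: "finite (Field E)" "card (Field E) < 2 ^ (2 * t + 2)" by linarith+
  have "\<exists>d\<in>E. \<exists>y. length y = (2 * t + 2) + R + 1 \<and>
    (\<forall>ys. z @ y @ ys \<in> Tverts n \<longrightarrow> f (z @ y @ ys) \<in> Field ((expand ^^ (p - t')) {d}))"
  proof (rule subtree_into_subdiamond[OF m' E R _ _ cardE])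
    show "length z + (2 * t + 2) + R + 1 \<le> n" using H z by simp
    show "\<exists>d\<in>E. f (z @ ys) \<in> Field ((expand ^^ (p - t')) {d})" if "z @ ys \<in> Tverts n" for ys
      using z(2)[OF that] unfolding split by (auto simp: Field_def)
  qed
  then obtain d y where d: "d \<in> E" and y: "length y = (2 * t + 2) + R + 1"
    "\<And>ys. z @ y @ ys \<in> Tverts n \<Longrightarrow> f (z @ y @ ys) \<in> Field ((expand ^^ (p - t')) {d})" by auto

  \<comment> \<open>The root and a deepest vertex of the trapped subtree: at least
    \<open>n - H\<close>, hence \<open>n / 2\<close>, apart, with images in one small
    subdiamond.\<close>
  define x1 where "x1 = z @ y @ []"
  define x2 where "x2 = z @ y @ replicate (n - H) False"
  have lx: "length x1 = H" "length x2 = n" using z(1) y(1) H Hn by (auto simp: x1_def x2_def)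
  then have x: "x1 \<in> Tverts n" "x2 \<in> Tverts n" using Hn by (auto simp: Tverts_def)
  obtain u v where uv: "d = (u, v)" by force
  have "(u, v) \<in> Dedges (j + t')" using d E uv by auto
  from subdiamond_diameter[OF this, of "f x1" "p - t'" "f x2"]
  have "gdist (Dedges m) (f x1) (f x2) \<le> 4 * 2 ^ (p - t')"
    using y(2) x uv m' unfolding x1_def x2_def by metis
  then have "real (gdist (Dedges m) (f x1) (f x2)) \<le> real (4 * 2 ^ (p - t'))" by (rule of_nat_mono)
  then have "dD m (f x1) (f x2) \<le> 4 * 2 ^ (p - t')" by (simp add: dD_def)
  then have "\<beta> * dD m (f x1) (f x2) \<le> \<beta> * (4 * 2 ^ (p - t'))" using pos by (intro mult_left_mono)
  moreover have "real n - H \<le> dT n x1 x2" using dT_ge_length_diff[OF x] lx by simp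
  ultimately have main: "real n / 2 \<le> \<beta> * (4 * 2 ^ (p - t'))" using lower[OF x] H(2) by linarith
  \<comment> \<open>For \<open>t \<le> p\<close> the factor \<open>2 ^ t\<close> beats
    \<open>64 * K\<close>, where 64 collects 4 (diameter), 2 (half depth), 2 (\<open>scale\<close>)
    and 4 (\<open>2 * n + 2 \<le> 4 * n\<close>). Otherwise the last subdiamond is one edge and
    \<open>8 * K < n\<close> decides.\<close>
  show False
  proof (cases "t \<le> p")
    case True
    then have eq: "2 ^ p = 2 ^ (p - t') * (2 ^ t :: real)" by (simp add: t'_def flip: power_add)
    have "real n / 2 * 2 ^ t \<le> \<beta> * (4 * 2 ^ (p - t')) * 2 ^ t"
      using main by (intro mult_right_mono) auto
    also have "\<dots> = \<beta> * 4 * 2 ^ p" by (simp add: eq)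
    finally have "real n / 2 * 2 ^ t \<le> \<beta> * 4 * 2 ^ p" .
    also have "\<dots> \<le> \<beta> * 4 * (2 * ((2 * n + 2) * \<alpha>))"
      using scale pos by (intro mult_left_mono) auto
    also have "\<dots> = 8 * (2 * n + 2) * (\<alpha> * \<beta>)" by (simp add: algebra_simps)
    also have "\<dots> \<le> 8 * (2 * n + 2) * K" using prod_le by (intro mult_left_mono) auto
    also have "\<dots> \<le> 32 * n * K"
    proof -
      have "0 \<le> K" using prod_le pos mult_nonneg_nonneg[of \<alpha> \<beta>] by linarith
      then show ?thesis using n(1) by (intro mult_right_mono) auto
    qed
    finally have "real n * 2 ^ t \<le> real n * (64 * K)" by simp
    then show False using t n(1) by (simp add: mult_le_cancel_left)
  next
    case False
    then have "real n / 2 \<le> 4 * \<beta>" using main by (simp add: t'_def)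
    moreover have "\<beta> \<le> \<alpha> * \<beta>" using \<alpha> pos by (simp add: mult_le_cancel_right1)
    ultimately show False using prod_le n(2) by linarith
  qed
qed

end

section \<open>From distortion to pointwise bounds\<close>

lemma lip_upper:
  assumes "finite A" "x \<in> A" "y \<in> A" "x \<noteq> y" "0 < dA x y"
  shows "dB (f x) (f y) \<le> lip dA dB A f * dA x y"
proof -
  let ?P = "{(x, y). x \<in> A \<and> y \<in> A \<and> x \<noteq> y}"
  \<comment> \<open>Finiteness bounds the set of quotients, so the supremum in \<open>lip\<close>
    dominates each of them.\<close>
  have "finite ?P" by (rule finite_subset[of _ "A \<times> A"]) (use assms(1) in auto)
  then have "dB (f x) (f y) / dA x y \<le> lip dA dB A f"
    unfolding lip_def using assms by (intro cSUP_upper2[of _ _ "(x, y)"]) auto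
  then show ?thesis using assms(5) by (simp add: divide_le_eq)
qed

lemma dT_pos: "x \<in> Tverts n \<Longrightarrow> y \<in> Tverts n \<Longrightarrow> x \<noteq> y \<Longrightarrow> 0 < dT n x y"
  using gdist_pos[OF Tedges_connected] by (simp add: dT_def)

lemma dD_pos: "x \<in> Dverts m \<Longrightarrow> y \<in> Dverts m \<Longrightarrow> x \<noteq> y \<Longrightarrow> 0 < dD m x y"
  using gdist_pos[OF Dedges_connected] by (simp add: dD_def Dverts_Field)

lemma gdist_self: "gdist E x x = 0"
  using gdist_le[of x x 0 E] by simp

lemma tree_in_diamondI:
  assumes n: "n \<ge> 1" and img: "f ` Tverts n \<subseteq> Dverts m" and inj: "inj_on f (Tverts n)"
    and K: "distortion (dT n) (dD m) (Tverts n) f \<le> K"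
  shows "tree_in_diamond n m f (lip (dT n) (dD m) (Tverts n) f)
    (lip (dD m) (dT n) (f ` Tverts n) (inv_into (Tverts n) f)) K"
proof -
  let ?\<alpha> = "lip (dT n) (dD m) (Tverts n) f"
  let ?\<beta> = "lip (dD m) (dT n) (f ` Tverts n) (inv_into (Tverts n) f)"
  have fpos: "0 < dD m (f x) (f y)" if "x \<in> Tverts n" "y \<in> Tverts n" "x \<noteq> y" for x y
    using that img inj by (intro dD_pos) (auto dest: inj_onD)
  have up: "dD m (f x) (f y) \<le> ?\<alpha> * dT n x y" if "x \<in> Tverts n" "y \<in> Tverts n" "x \<noteq> y" for x y
    using that by (intro lip_upper finite_Tverts dT_pos)
  have lo: "dT n x y \<le> ?\<beta> * dD m (f x) (f y)" if "x \<in> Tverts n" "y \<in> Tverts n" "x \<noteq> y" for x y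
    using lip_upper[of "f ` Tverts n" "f x" "f y" "dD m" "dT n" "inv_into (Tverts n) f"]
      that inj fpos[OF that] finite_Tverts by (auto dest: inj_onD)
  \<comment> \<open>Since \<open>n \<ge> 1\<close>, there is a pair of distinct vertices, which
    forces both suprema to be positive.\<close>
  have ab: "[] \<in> Tverts n" "[False] \<in> Tverts n" "[] \<noteq> [False]" using n by (auto simp: Tverts_def)
  have "0 < ?\<alpha> * dT n [] [False]" using up[OF ab] fpos[OF ab] by linarith
  then have \<alpha>: "0 < ?\<alpha>" using dT_pos[OF ab] by (simp add: zero_less_mult_iff)
  have "0 < ?\<beta> * dD m (f []) (f [False])" using lo[OF ab] dT_pos[OF ab] by linarith
  then have \<beta>: "0 < ?\<beta>" using fpos[OF ab] by (simp add: zero_less_mult_iff)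
  show ?thesis
  proof
    fix x y assume xy: "x \<in> Tverts n" "y \<in> Tverts n"
    show "dD m (f x) (f y) \<le> ?\<alpha> * dT n x y"
      using up[OF xy] by (cases "x = y") (auto simp: dD_def dT_def gdist_self)
    show "dT n x y \<le> ?\<beta> * dD m (f x) (f y)"
      using lo[OF xy] by (cases "x = y") (auto simp: dD_def dT_def gdist_self)
  qed (use \<alpha> \<beta> K img in \<open>auto simp: distortion_def Dverts_Field\<close>)
qed

theorem theoremT:
  shows "\<not> (\<exists>(K::real) (m::nat \<Rightarrow> nat) (f::nat \<Rightarrow> bool list \<Rightarrow> dvert).
            \<forall>n\<ge>1. f n ` Tverts n \<subseteq> Dverts (m n)
                 \<and> inj_on (f n) (Tverts n)
                 \<and> distortion (dT n) (dD (m n)) (Tverts n) (f n) \<le> K)"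
proof
  assume "\<exists>(K::real) (m::nat \<Rightarrow> nat) (f::nat \<Rightarrow> bool list \<Rightarrow> dvert).
            \<forall>n\<ge>1. f n ` Tverts n \<subseteq> Dverts (m n)
                 \<and> inj_on (f n) (Tverts n)
                 \<and> distortion (dT n) (dD (m n)) (Tverts n) (f n) \<le> K"
  then obtain K :: real and m f where emb: "\<And>n. n \<ge> 1 \<Longrightarrow> f n ` Tverts n \<subseteq> Dverts (m n)
      \<and> inj_on (f n) (Tverts n) \<and> distortion (dT n) (dD (m n)) (Tverts n) (f n) \<le> K"
    by blast
  obtain t where t: "64 * K < 2 ^ t" using real_arch_pow[of 2 "64 * K"] by auto
  obtain R :: nat where R: "2 * K \<le> R" using real_arch_simple by blast
  obtain N :: nat where N: "8 * K < N" using reals_Archimedean2 by blast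
  define H where "H = (2 + R + 1) + ((2 * t + 2) + R + 1)"
  \<comment> \<open>\<open>2 * H\<close> leaves half the depth after both trappings, and
    \<open>N\<close> ensures \<open>8 * K < n\<close>.\<close>
  define n where "n = 2 * H + N"
  have n: "n \<ge> 1" "8 * K < n" "2 * H \<le> n" using N by (auto simp: n_def H_def)
  interpret tree_in_diamond n "m n" "f n" "lip (dT n) (dD (m n)) (Tverts n) (f n)"
    "lip (dD (m n)) (dT n) (f n ` Tverts n) (inv_into (Tverts n) (f n))" K
    using emb[OF n(1)] n(1) by (intro tree_in_diamondI) auto
  show False using depth_bounded[OF t R n(1,2) H_def n(3)] .
qed

end
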